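(* Let $P=\mathbb{C}[x_{ijk} : i,j,k\in\{0,1\}]$ be the polynomial algebra in the $8$ entries of a $2\times 2\times 2$ array $X=(x_{ijk})$, with the action of $SL_2(\mathbb{C})\times SL_2(\mathbb{C})\times SL_2(\mathbb{C})$ by changes of basis of determinant $1$ along the three directions. Let $C\in P$ be Cayley's hyperdeterminant. Then every $f\in P$ which is invariant under $SL_2(\mathbb{C})\times SL_2(\mathbb{C})\times SL_2(\mathbb{C})$ is a polynomial in $C$; that is, there exists a one-variable polynomial $p\in\mathbb{C}[t]$ with $f=p(C)$.
   Context: The group $SL_2(\mathbb{C})^3$ acts on $P=\mathbb{C}[x_{ijk}: i,j,k\in\{0,1\}]$ by $\mathbb{C}$-algebra automorphisms: identifying $x_{ijk}$ with the simple tensor $x_i\otimes x_j\otimes x_k\in\mathbb{C}^2\otimes\mathbb{C}^2\otimes\mathbb{C}^2$ (where $x_0,x_1$ is the standard basis of $\mathbb{C}^2$, with $SL_2(\mathbb{C})$ acting by matrix-vector multiplication), a triple $(A,B,D)$ with $A=(a_{pq})$, $B=(b_{pq})$, $D=(d_{pq})$ ($p,q\in\{0,1\}$) sends $x_{ijk}\mapsto\sum_{i',j',k'\in\{0,1\}}a_{i'i}\,b_{j'j}\,d_{k'k}\,x_{i'j'k'}$, and this is extended multiplicatively and linearly to $P$. A polynomial $f\in P$ is invariant if $(A,B,D)\cdot f=f$ for all $(A,B,D)\in SL_2(\mathbb{C})^3$. Cayley's hyperdeterminant is \begin{align*} C={}&x_{000}^2x_{111}^2+x_{001}^2x_{110}^2+x_{010}^2x_{101}^2+x_{011}^2x_{100}^2\\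 &-2\big(x_{000}x_{001}x_{110}x_{111}+x_{000}x_{010}x_{101}x_{111}+x_{000}x_{011}x_{100}x_{111}\\ &\qquad+x_{001}x_{010}x_{101}x_{110}+x_{001}x_{011}x_{100}x_{110}+x_{010}x_{011}x_{100}x_{101}\big)\\ &+4\big(x_{000}x_{011}x_{101}x_{110}+x_{001}x_{010}x_{100}x_{111}\big). \end{align*} *)

theory Defs
  imports "HOL-Analysis.Analysis" "HOL-Library.Poly_Mapping" "HOL-Computational_Algebra.Polynomial"
begin

text \<open>
  Multivariate polynomials over an arbitrary set of indeterminates, as finitely supported
  coefficient functions on finitely supported exponent vectors; the ring structure is
  the convolution product of \<^theory>\<open>HOL-Library.Poly_Mapping\<close>.
\<close>

type_synonym ('i, 'a) mpolynomial = "('i \<Rightarrow>\<^sub>0 nat) \<Rightarrow>\<^sub>0 'a"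

definition mconst :: "'a::zero \<Rightarrow> ('i, 'a) mpolynomial" where
  "mconst c = Poly_Mapping.single 0 c"

definition mvar :: "'i \<Rightarrow> ('i, 'a::zero_neq_one) mpolynomial" where
  "mvar i = Poly_Mapping.single (Poly_Mapping.single i 1) 1"

definition msubst ::
    "('i \<Rightarrow> ('j, 'a) mpolynomial) \<Rightarrow> ('i, 'a::comm_ring_1) mpolynomial \<Rightarrow> ('j, 'a) mpolynomial" where
  "msubst \<phi> f =
     (\<Sum>m\<in>Poly_Mapping.keys f. mconst (Poly_Mapping.lookup f m) *
        (\<Prod>i\<in>Poly_Mapping.keys m. \<phi> i ^ Poly_Mapping.lookup m i))"

text \<open>
  The index set \<open>{0,1}\<close> is the two-element type \<^typ>\<open>2\<close>, whose elements are \<open>0\<close> and \<open>1\<close>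
  (the literal \<open>2\<close> denotes \<open>0\<close> there). It also indexes the matrices, and
  \<open>A $ p $ q\<close> is the entry in row \<open>p\<close> and column \<open>q\<close>.
\<close>

type_synonym tensor_poly = "(2 \<times> 2 \<times> 2, complex) mpolynomial"

abbreviation X :: "2 \<Rightarrow> 2 \<Rightarrow> 2 \<Rightarrow> tensor_poly" where
  "X i j k \<equiv> mvar (i, j, k)"

definition SL2 :: "(complex^2^2) set" where
  "SL2 = {A. det A = 1}"

definition act :: "complex^2^2 \<Rightarrow> complex^2^2 \<Rightarrow> complex^2^2 \<Rightarrow> tensor_poly \<Rightarrow> tensor_poly" where
  "act A B D = msubst (\<lambda>(i, j, k).
     \<Sum>i'\<in>UNIV. \<Sum>j'\<in>UNIV. \<Sum>k'\<in>UNIV. mconst (A $ i' $ i * B $ j' $ j * D $ k' $ k) * X i' j' k')"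

definition invariant :: "tensor_poly \<Rightarrow> bool" where
  "invariant f \<longleftrightarrow> (\<forall>A\<in>SL2. \<forall>B\<in>SL2. \<forall>D\<in>SL2. act A B D f = f)"

definition hyperdet :: tensor_poly where
  "hyperdet =
     (X 0 0 0)^2 * (X 1 1 1)^2 + (X 0 0 1)^2 * (X 1 1 0)^2
     + (X 0 1 0)^2 * (X 1 0 1)^2 + (X 0 1 1)^2 * (X 1 0 0)^2
     - 2 * (X 0 0 0 * X 0 0 1 * X 1 1 0 * X 1 1 1
          + X 0 0 0 * X 0 1 0 * X 1 0 1 * X 1 1 1
          + X 0 0 0 * X 0 1 1 * X 1 0 0 * X 1 1 1
          + X 0 0 1 * X 0 1 0 * X 1 0 1 * X 1 1 0
          + X 0 0 1 * X 0 1 1 * X 1 0 0 * X 1 1 0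
          + X 0 1 0 * X 0 1 1 * X 1 0 0 * X 1 0 1)
     + 4 * (X 0 0 0 * X 0 1 1 * X 1 0 1 * X 1 1 0
          + X 0 0 1 * X 0 1 0 * X 1 0 0 * X 1 1 1)"

definition peval :: "'a poly \<Rightarrow> ('i, 'a::comm_ring_1) mpolynomial \<Rightarrow> ('i, 'a) mpolynomial" where
  "peval p g = poly (map_poly mconst p) g"

end

theory Submission imports Defs begin

text \<open>
  The idea is to find a curve of tensors that meets every orbit in general position.
  Regard a tensor \<open>x\<close> as a pair of \<open>2 \<times> 2\<close> matrices, its slices \<open>M\<^sub>0 = (x\<^sub>i\<^sub>j\<^sub>0)\<close> and
  \<open>M\<^sub>1 = (x\<^sub>i\<^sub>j\<^sub>1)\<close>. The first two factors of the group multiply both slices on the left and on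
  the right, and the third one takes linear combinations of the slices. If \<open>M\<^sub>0\<close> is
  invertible, a rescaling of the slices by \<open>t\<close> and \<open>1/t\<close> gives it determinant 1, and a left
  multiplication turns it into the identity. Subtracting a multiple of it from the second slice
  makes that one traceless, and what remains of the action is conjugation of the second slice.
  In general, a traceless matrix is conjugate under \<open>SL\<^sub>2\<close> to one with diagonal \<open>0, 0\<close>, lower
  left entry 1 and upper right entry \<open>u\<close> for some \<open>u\<close>. So a generic tensor lies in the orbit of a
  point of the line \<open>slice_point\<close>, on which Cayley's hyperdeterminant is \<open>4u\<close>; as the
  hyperdeterminant is itself invariant, the parameter must be \<open>u = C(x)/4\<close>. This is
  \<open>generic_tensor_in_slice_orbit\<close>, in which the transforming matrices are given explicitly.

  An invariant \<open>f\<close> restricts to a one-variable polynomial \<open>q\<close> on that line, hence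
  \<open>f(x) = q(C(x)/4)\<close> for generic \<open>x\<close>. Genericity is the non-vanishing of a polynomial, so the
  two sides agree as polynomials by \<open>mpolynomial_zeroI_generic\<close>, which rests on the fact that a
  polynomial over an infinite domain is determined by its values.
\<close>

section \<open>Evaluating multivariate polynomials\<close>

definition monomial_value :: "('i \<Rightarrow> 'a) \<Rightarrow> ('i \<Rightarrow>\<^sub>0 nat) \<Rightarrow> 'a::comm_ring_1" where
  "monomial_value v m = (\<Prod>i\<in>Poly_Mapping.keys m. v i ^ Poly_Mapping.lookup m i)"

definition meval :: "('i \<Rightarrow> 'a) \<Rightarrow> ('i, 'a::comm_ring_1) mpolynomial \<Rightarrow> 'a" where
  "meval v f = (\<Sum>m\<in>Poly_Mapping.keys f. Poly_Mapping.lookup f m * monomial_value v m)"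

lemma monomial_value_superset:
  assumes "finite S" "Poly_Mapping.keys m \<subseteq> S"
  shows "monomial_value v m = (\<Prod>i\<in>S. v i ^ Poly_Mapping.lookup m i)"
  unfolding monomial_value_def
  by (rule prod.mono_neutral_left) (use assms in \<open>auto simp: in_keys_iff\<close>)

lemma monomial_value_add: "monomial_value v (m + n) = monomial_value v m * monomial_value v n"
proof -
  let ?S = "Poly_Mapping.keys m \<union> Poly_Mapping.keys n"
  have "Poly_Mapping.keys (m + n) \<subseteq> ?S"
    by (rule Poly_Mapping.keys_add)
  then show ?thesis
    by (simp add: monomial_value_superset[of ?S] lookup_add power_add prod.distrib)
qed

lemma meval_superset:
  assumes "finite S" "Poly_Mapping.keys f \<subseteq> S"
  shows "meval v f = (\<Sum>m\<in>S. Poly_Mapping.lookup f m * monomial_value v m)"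
  unfolding meval_def
  by (rule sum.mono_neutral_left) (use assms in \<open>auto simp: in_keys_iff\<close>)

lemma meval_0 [simp]: "meval v 0 = 0"
  by (simp add: meval_def)

lemma meval_add [simp]: "meval v (f + g) = meval v f + meval v g"
proof -
  let ?S = "Poly_Mapping.keys f \<union> Poly_Mapping.keys g"
  have "Poly_Mapping.keys (f + g) \<subseteq> ?S"
    by (rule Poly_Mapping.keys_add)
  then show ?thesis
    by (simp add: meval_superset[of ?S] lookup_add distrib_right sum.distrib)
qed

lemma meval_uminus [simp]: "meval v (- f) = - meval v f"
  using meval_add[of v f "- f"] by (simp add: eq_neg_iff_add_eq_0 add.commute)

lemma meval_diff [simp]: "meval v (f - g) = meval v f - meval v g"
  using meval_add[of v f "- g"] by simp

lemma meval_sum [simp]: "meval v (\<Sum>x\<in>S. F x) = (\<Sum>x\<in>S. meval v (F x))"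
  by (induction S rule: infinite_finite_induct) auto

lemma meval_single: "meval v (Poly_Mapping.single m c) = c * monomial_value v m"
  by (cases "c = 0") (simp_all add: meval_def)

text \<open>The decomposition into monomials reduces multiplicativity of evaluation to
  \<open>monomial_value_add\<close>.\<close>

lemma mpolynomial_as_sum:
  "f = (\<Sum>m\<in>Poly_Mapping.keys f. Poly_Mapping.single m (Poly_Mapping.lookup f m))"
  by (rule poly_mapping_eqI) (simp add: lookup_sum lookup_single when_def in_keys_iff)

lemma meval_mult [simp]: "meval v (f * g) = meval v f * meval v g"
proof -
  let ?a = "\<lambda>m. Poly_Mapping.single m (Poly_Mapping.lookup f m)"
  let ?b = "\<lambda>n. Poly_Mapping.single n (Poly_Mapping.lookup g n)"
  have "f * g = (\<Sum>m\<in>Poly_Mapping.keys f. ?a m) * (\<Sum>n\<in>Poly_Mapping.keys g. ?b n)"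
    using mpolynomial_as_sum[of f] mpolynomial_as_sum[of g] by simp
  also have "meval v \<dots> = meval v f * meval v g"
    by (simp add: sum_product mult_single meval_single monomial_value_add meval_def[of v f]
        meval_def[of v g] mult.assoc mult.left_commute)
  finally show ?thesis .
qed

lemma meval_mconst [simp]: "meval v (mconst c) = c"
  by (simp add: mconst_def meval_single monomial_value_def)

lemma meval_mvar [simp]: "meval v (mvar i) = v i"
  by (simp add: mvar_def meval_single monomial_value_def)

lemma meval_1 [simp]: "meval v 1 = 1"
  using meval_mconst[of v 1] by (simp add: mconst_def)

lemma meval_numeral [simp]: "meval v (numeral n) = numeral n"
proof -
  have "meval v (of_nat k) = of_nat k" for k
    by (induction k) auto
  from this[of "numeral n"] show ?thesis by simp
qed

lemma meval_power [simp]: "meval v (f ^ n) = meval v f ^ n"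
  by (induction n) auto

lemma meval_prod [simp]: "meval v (\<Prod>x\<in>S. F x) = (\<Prod>x\<in>S. meval v (F x))"
  by (induction S rule: infinite_finite_induct) auto

lemma meval_msubst: "meval v (msubst \<phi> f) = meval (\<lambda>i. meval v (\<phi> i)) f"
  by (simp add: msubst_def meval_def[of _ f] monomial_value_def)

lemma meval_peval: "meval v (peval p g) = poly p (meval v g)"
proof -
  have 0: "mconst 0 = 0"
    by (simp add: mconst_def)
  show ?thesis
    by (induction p) (simp_all add: peval_def map_poly_pCons 0)
qed

text \<open>
  Restriction to a parametrised curve reduces statements about values to the theory of
  one-variable polynomials; below, the curves are the normal form of generic tensors and the
  lines through a given point.
\<close>

lemma meval_along_curve:
  fixes f :: "('i, 'a::comm_ring_1) mpolynomial"
  obtains q where "\<And>t. poly q t = meval (\<lambda>i. poly (\<rho> i) t) f"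
proof
  show "poly (\<Sum>m\<in>Poly_Mapping.keys f. smult (Poly_Mapping.lookup f m)
      (\<Prod>i\<in>Poly_Mapping.keys m. \<rho> i ^ Poly_Mapping.lookup m i)) t
      = meval (\<lambda>i. poly (\<rho> i) t) f" for t
    by (simp add: meval_def monomial_value_def poly_sum poly_prod)
qed

section \<open>Polynomials are determined by their values\<close>

text \<open>
  Kronecker's substitution: the weights are the powers of \<open>N\<close>, so that the weighted degree of an
  exponent vector with entries below \<open>N\<close> is a number with these entries as its digits in base
  \<open>N\<close>. The induction adds the new variable as the last digit and shifts the other ones.
\<close>

lemma separating_weights:
  assumes "finite I"
  shows "\<exists>w :: 'i \<Rightarrow> nat. \<forall>a b. (\<forall>i\<in>I. a i < N \<and> b i < N) \<longrightarrow>
    (\<Sum>i\<in>I. w i * a i) = (\<Sum>i\<in>I. w i * b i) \<longrightarrow> (\<forall>i\<in>I. a i = b i)"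
  using assms
proof induction
  case empty
  then show ?case by simp
next
  case (insert k I)
  from insert.IH obtain w :: "'i \<Rightarrow> nat" where
    w: "\<forall>a b. (\<forall>i\<in>I. a i < N \<and> b i < N) \<longrightarrow>
      (\<Sum>i\<in>I. w i * a i) = (\<Sum>i\<in>I. w i * b i) \<longrightarrow> (\<forall>i\<in>I. a i = b i)" ..
  let ?w = "\<lambda>i. if i = k then 1 else N * w i"
  have split: "(\<Sum>i\<in>insert k I. ?w i * c i) = c k + N * (\<Sum>i\<in>I. w i * c i)" for c :: "'i \<Rightarrow> nat"
  proof -
    have "(\<Sum>i\<in>I. ?w i * c i) = (\<Sum>i\<in>I. N * (w i * c i))"
      using insert.hyps by (intro sum.cong) auto
    then show ?thesis
      using insert.hyps by (simp add: sum_distrib_left)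
  qed
  have "\<forall>i\<in>insert k I. a i = b i"
    if lt: "\<forall>i\<in>insert k I. a i < N \<and> b i < N"
      and eq: "(\<Sum>i\<in>insert k I. ?w i * a i) = (\<Sum>i\<in>insert k I. ?w i * b i)"
    for a b :: "'i \<Rightarrow> nat"
  proof -
    have eq': "a k + N * (\<Sum>i\<in>I. w i * a i) = b k + N * (\<Sum>i\<in>I. w i * b i)"
      using eq unfolding split .
    have "a k < N" "b k < N"
      using lt by auto
    with arg_cong[OF eq', of "\<lambda>x. x mod N"] have k: "a k = b k"
      by simp
    with eq' \<open>a k < N\<close> have "(\<Sum>i\<in>I. w i * a i) = (\<Sum>i\<in>I. w i * b i)"
      by simp
    with w lt have "\<forall>i\<in>I. a i = b i"
      by simp
    with k show ?thesis
      by simp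
  qed
  then show ?case
    by (intro exI[of _ ?w]) blast
qed

text \<open>
  With separating weights \<open>w\<close>, the substitution \<open>i \<mapsto> t ^ w i\<close> sends distinct monomials
  of \<open>f\<close> to distinct powers of \<open>t\<close>. The resulting one-variable polynomial has the coefficients
  of \<open>f\<close>, and it is zero since it has infinitely many roots.
\<close>

theorem mpolynomial_zeroI:
  fixes f :: "('i, 'a::idom) mpolynomial"
  assumes "infinite (UNIV :: 'a set)" and zero: "\<And>v. meval v f = 0"
  shows "f = 0"
proof -
  define I where "I = (\<Union>m\<in>Poly_Mapping.keys f. Poly_Mapping.keys m)"
  have I: "finite I"
    by (simp add: I_def)
  let ?E = "(\<lambda>(m, i). Poly_Mapping.lookup m i) ` (Poly_Mapping.keys f \<times> I)"
  define N where "N = Suc (Max ?E)"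
  have N: "Poly_Mapping.lookup m i < N" if "m \<in> Poly_Mapping.keys f" "i \<in> I" for m i
  proof -
    have "Poly_Mapping.lookup m i \<in> ?E"
      using that by force
    then show ?thesis
      unfolding N_def using I by (simp add: le_imp_less_Suc)
  qed
  obtain w :: "'i \<Rightarrow> nat" where
    w: "\<forall>a b. (\<forall>i\<in>I. a i < N \<and> b i < N) \<longrightarrow>
      (\<Sum>i\<in>I. w i * a i) = (\<Sum>i\<in>I. w i * b i) \<longrightarrow> (\<forall>i\<in>I. a i = b i)"
    using separating_weights[OF I] ..
  define deg where "deg m = (\<Sum>i\<in>I. w i * Poly_Mapping.lookup m i)" for m
  have keys_I: "Poly_Mapping.keys m \<subseteq> I" if "m \<in> Poly_Mapping.keys f" for m
    using that by (auto simp: I_def)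
  have inj: "m = n"
    if m: "m \<in> Poly_Mapping.keys f" and n: "n \<in> Poly_Mapping.keys f" and "deg m = deg n" for m n
  proof (rule poly_mapping_eqI)
    fix i
    show "Poly_Mapping.lookup m i = Poly_Mapping.lookup n i"
    proof (cases "i \<in> I")
      case True
      show ?thesis
        using w[rule_format, of "Poly_Mapping.lookup m" "Poly_Mapping.lookup n" i]
          N m n \<open>deg m = deg n\<close> True by (simp add: deg_def)
    next
      case False
      then have "i \<notin> Poly_Mapping.keys m" "i \<notin> Poly_Mapping.keys n"
        using keys_I[OF m] keys_I[OF n] by blast+
      then show ?thesis
        by (simp add: in_keys_iff)
    qed
  qed
  define q where "q = (\<Sum>m\<in>Poly_Mapping.keys f. monom (Poly_Mapping.lookup f m) (deg m))"
  have "poly q t = 0" for t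
  proof -
    have "monomial_value (\<lambda>i. t ^ w i) m = t ^ deg m" if "m \<in> Poly_Mapping.keys f" for m
      using monomial_value_superset[OF I keys_I[OF that], of "\<lambda>i. t ^ w i"]
      by (simp add: deg_def power_sum power_mult)
    then have "poly q t = meval (\<lambda>i. t ^ w i) f"
      by (simp add: q_def poly_sum poly_monom meval_def)
    then show ?thesis
      using zero by simp
  qed
  then have "q = 0"
    using poly_roots_finite[of q] assms(1) by auto
  have "Poly_Mapping.lookup f m = 0" for m
  proof (rule ccontr)
    assume "Poly_Mapping.lookup f m \<noteq> 0"
    then have m: "m \<in> Poly_Mapping.keys f"
      by (simp add: in_keys_iff)
    have "coeff q (deg m)
        = (\<Sum>n\<in>Poly_Mapping.keys f. if n = m then Poly_Mapping.lookup f n else 0)"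
      unfolding q_def coeff_sum by (intro sum.cong) (use inj m in auto)
    also have "\<dots> = Poly_Mapping.lookup f m"
      using m by simp
    finally show False
      using \<open>q = 0\<close> \<open>Poly_Mapping.lookup f m \<noteq> 0\<close> by simp
  qed
  then show ?thesis
    by (intro poly_mapping_eqI) simp
qed

text \<open>
  The set where \<open>g\<close> does not vanish is Zariski dense if it is nonempty. To see this, join an
  arbitrary point \<open>v\<close> to \<open>y\<close> by a line: along it, \<open>g\<close> is a nonzero polynomial in one variable and
  \<open>f g\<close> vanishes identically, so \<open>f\<close> vanishes on the whole line.
\<close>

lemma mpolynomial_zeroI_generic:
  fixes f g :: "('i, 'a::idom) mpolynomial"
  assumes inf: "infinite (UNIV :: 'a set)"
    and y: "meval y g \<noteq> 0"
    and generic: "\<And>v. meval v g \<noteq> 0 \<Longrightarrow> meval v f = 0"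
  shows "f = 0"
proof (rule mpolynomial_zeroI[OF inf])
  fix v
  define \<rho> where "\<rho> i = [:v i, y i - v i:]" for i
  obtain p where p: "\<And>t. poly p t = meval (\<lambda>i. poly (\<rho> i) t) f"
    using meval_along_curve[of \<rho> f] by blast
  obtain q where q: "\<And>t. poly q t = meval (\<lambda>i. poly (\<rho> i) t) g"
    using meval_along_curve[of \<rho> g] by blast
  have "poly (p * q) t = 0" for t
    using generic[of "\<lambda>i. poly (\<rho> i) t"] by (auto simp: p q)
  then have "p * q = 0"
    using poly_roots_finite[of "p * q"] inf by auto
  moreover have "poly q 1 \<noteq> 0"
    using y by (simp add: q \<rho>_def)
  ultimately have "p = 0"
    by auto
  then show "meval v f = 0"
    using p[of 0] by (simp add: \<rho>_def)
qed

section \<open>A slice for the generic orbits\<close>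

text \<open>The tensor whose slices \<open>(x\<^sub>i\<^sub>j\<^sub>0)\<close> and \<open>(x\<^sub>i\<^sub>j\<^sub>1)\<close> are the identity and the traceless matrix
  with rows \<open>(0, u)\<close> and \<open>(1, 0)\<close>.\<close>

definition slice_point :: "complex \<Rightarrow> 2 \<times> 2 \<times> 2 \<Rightarrow> complex" where
  "slice_point u = (\<lambda>_. 0)((0, 0, 0) := 1, (1, 1, 0) := 1, (1, 0, 1) := 1, (0, 1, 1) := u)"

text \<open>
  The map on points that is dual to the action on polynomials, see \<open>meval_act\<close>. The sums run
  over the row indices, so the first slot is transformed by the transpose of \<open>A\<close>, that is, both
  slices are multiplied by it on the left and by \<open>B\<close> on the right.
\<close>

definition transform ::
    "complex^2^2 \<Rightarrow> complex^2^2 \<Rightarrow> complex^2^2 \<Rightarrow> (2 \<times> 2 \<times> 2 \<Rightarrow> complex) \<Rightarrow> 2 \<times> 2 \<times> 2 \<Rightarrow> complex" where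
  "transform A B D x = (\<lambda>(i, j, k). \<Sum>i'\<in>UNIV. \<Sum>j'\<in>UNIV. \<Sum>k'\<in>UNIV.
     A $ i' $ i * B $ j' $ j * D $ k' $ k * x (i', j', k'))"

lemma meval_act: "meval x (act A B D f) = meval (transform A B D x) f"
  unfolding act_def meval_msubst
  by (rule arg_cong[of _ _ "\<lambda>v. meval v f"]) (auto simp: transform_def fun_eq_iff)

lemma two_eq_zero: "(2::2) = 0"
  by simp

lemma sum_2': "(\<Sum>i\<in>UNIV. h i) = h (0::2) + h 1"
  using sum_2[of h] by (simp add: two_eq_zero add.commute)

definition mat2 :: "complex \<Rightarrow> complex \<Rightarrow> complex \<Rightarrow> complex \<Rightarrow> complex^2^2" where
  "mat2 a b c d = (\<chi> i j. if i = 0 then if j = 0 then a else b else if j = 0 then c else d)"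

lemma mat2_nth [simp]:
  "mat2 a b c d $ 0 $ 0 = a" "mat2 a b c d $ 0 $ 1 = b"
  "mat2 a b c d $ 1 $ 0 = c" "mat2 a b c d $ 1 $ 1 = d"
  by (simp_all add: mat2_def)

lemma mat2_SL2: "mat2 a b c d \<in> SL2 \<longleftrightarrow> a * d - b * c = 1"
  by (simp add: SL2_def det_2 two_eq_zero algebra_simps)

text \<open>
  The first factor is the determinant of the slice \<open>M\<^sub>0\<close>. The second one is the lower left entry
  of \<open>M\<^sub>1 adj(M\<^sub>0)\<close>; if it is nonzero, the first unit vector is not an eigenvector of that matrix,
  hence it can be the start of a basis in which the matrix takes the form required by
  \<open>slice_point\<close>.
\<close>

definition genericity :: tensor_poly where
  "genericity = (X 0 0 0 * X 1 1 0 - X 0 1 0 * X 1 0 0) * (X 1 0 1 * X 1 1 0 - X 1 1 1 * X 1 0 0)"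

text \<open>
  Write \<open>\<delta>\<close> for the determinant of \<open>M\<^sub>0\<close> and let \<open>H = M\<^sub>1 adj(M\<^sub>0) - T\<close> be the traceless part of
  \<open>M\<^sub>1 adj(M\<^sub>0)\<close>, with first row \<open>(K, L)\<close> and second row \<open>(M, -K)\<close>. Let \<open>N\<close> be the second slice
  of \<open>slice_point u\<close> and \<open>P\<close> the matrix with columns \<open>v\<close> and \<open>H v\<close>, where \<open>v = (w, 0)\<close>. As
  \<open>H\<^sup>2\<close> is the scalar matrix \<open>K\<^sup>2 + L M = u\<close>, it satisfies \<open>H P = P N\<close>, and \<open>w\<^sup>2 M = 1\<close> makes its determinant 1.
  With \<open>s\<^sup>2 = \<delta>\<close>, the matrices below are \<open>A = P\<^sup>T\<close> and \<open>B = P\<^sup>-\<^sup>1 M\<^sub>0 / s\<close>, so the first slice of the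
  transformed tensor is \<open>s P B = M\<^sub>0\<close>, and the second one is
  \<open>(T/s) P B + (1/s) P N B = (T + H) M\<^sub>0 / \<delta> = M\<^sub>1\<close>.
\<close>

lemma generic_tensor_in_slice_orbit:
  assumes "meval x genericity \<noteq> 0"
  obtains A B D where "A \<in> SL2" "B \<in> SL2" "D \<in> SL2"
    "x = transform A B D (slice_point (meval x hyperdet / 4))"
proof -
  define a b c d where abcd: "a = x (0,0,0)" "b = x (0,1,0)" "c = x (1,0,0)" "d = x (1,1,0)"
  define e f g h where efgh: "e = x (0,0,1)" "f = x (0,1,1)" "g = x (1,0,1)" "h = x (1,1,1)"
  define T where "T = (e * d - f * c - g * b + h * a) / 2"
  define K where "K = e * d - f * c - T"
  define L where "L = f * a - e * b"
  define M where "M = g * d - h * c"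
  define s where "s = csqrt (a * d - b * c)"
  define w where "w = 1 / csqrt M"
  define u where "u = meval x hyperdet / 4"
  have nz: "a * d - b * c \<noteq> 0" "M \<noteq> 0"
    using assms by (auto simp: genericity_def abcd efgh M_def)
  have s2: "s * s = a * d - b * c" and s0: "s \<noteq> 0"
    using nz by (auto simp: s_def simp flip: power2_eq_square)
  have w2: "w * w * M = 1"
    using nz by (auto simp: w_def power_divide simp flip: power2_eq_square)
  \<comment> \<open>The hyperdeterminant is the discriminant of the characteristic polynomial of \<open>M\<^sub>1 adj(M\<^sub>0)\<close>.\<close>
  have u: "u = K * K + L * M"
    unfolding u_def K_def L_def M_def T_def hyperdet_def abcd efgh
    by (simp add: field_simps power2_eq_square)
  define A where "A = mat2 w 0 (K * w) (M * w)"
  define B where "B = mat2 ((M * w * a - K * w * c) / s) ((M * w * b - K * w * d) / s) (w * c / s) (w * d / s)"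
  define D where "D = mat2 s (T / s) 0 (1 / s)"
  show ?thesis
  proof (rule that[of A B D])
    show "A \<in> SL2"
      using w2 by (simp add: A_def mat2_SL2 ac_simps)
    show "D \<in> SL2"
      using s0 by (simp add: D_def mat2_SL2)
    have "(M * w * a - K * w * c) / s * (w * d / s) - (M * w * b - K * w * d) / s * (w * c / s)
        = (w * w * M) * (a * d - b * c) / (s * s)"
      using s0 by (simp add: field_simps)
    then show "B \<in> SL2"
      using nz by (simp add: B_def mat2_SL2 w2 s2)
    \<comment> \<open>The entries of \<open>P B\<close> (\<open>PB\<close>, \<open>MB\<close>) and of \<open>P N B\<close> (\<open>PNB\<close>, \<open>MNB\<close>), for the first and
      for the second row of \<open>P\<close>; \<open>(y, z)\<close> stands for a column of \<open>M\<^sub>0\<close>.\<close>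
    have PB: "w * ((M * w * y - K * w * z) / s) + K * w * (w * z / s) = y / s" for y z
    proof -
      have "w * (M * w * y - K * w * z) + K * w * (w * z) = (w * w * M) * y"
        by (simp add: algebra_simps)
      then show ?thesis
        using s0 by (simp add: w2 flip: add_divide_distrib)
    qed
    have MB: "M * w * (w * z / s) = z / s" for z
      using w2 by (simp add: ac_simps)
    have PNB: "K * w * ((M * w * y - K * w * z) / s) + u * w * (w * z / s) = (K * y + L * z) / s" for y z
    proof -
      have "K * w * (M * w * y - K * w * z) + u * w * (w * z) = (w * w * M) * (K * y + L * z)"
        by (simp add: u algebra_simps)
      then show ?thesis
        using s0 by (simp add: w2 flip: add_divide_distrib)
    qed
    have MNB: "M * w * ((M * w * y - K * w * z) / s) = (M * y - K * z) / s" for y z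
    proof -
      have "M * w * (M * w * y - K * w * z) = (w * w * M) * (M * y - K * z)"
        by (simp add: algebra_simps)
      then show ?thesis
        using s0 by (simp add: w2)
    qed
    have slice1: "T * y / (s * s) + (K * y + L * z) / (s * s) = r"
      if "r * (a * d - b * c) = (T + K) * y + L * z" for y z r
      using that s0 by (simp add: divide_eq_eq algebra_simps flip: s2 add_divide_distrib)
    have slice2: "T * z / (s * s) + (M * y - K * z) / (s * s) = r"
      if "r * (a * d - b * c) = (T - K) * z + M * y" for y z r
      using that s0 by (simp add: divide_eq_eq algebra_simps flip: s2 add_divide_distrib)
    \<comment> \<open>The identity \<open>\<delta> M\<^sub>1 = (T + H) M\<^sub>0\<close>, entry by entry.\<close>
    have efgh': "e * (a * d - b * c) = (T + K) * a + L * c"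
        "f * (a * d - b * c) = (T + K) * b + L * d"
        "g * (a * d - b * c) = (T - K) * c + M * a"
        "h * (a * d - b * c) = (T - K) * d + M * b"
      unfolding K_def L_def M_def T_def by (simp_all add: field_simps)
    let ?y = "transform A B D (slice_point u)"
    have k0: "?y (i, j, 0) = s * (A $ 0 $ i * B $ 0 $ j + A $ 1 $ i * B $ 1 $ j)" for i j
      by (simp add: transform_def sum_2' slice_point_def D_def algebra_simps)
    have k1: "?y (i, j, 1) = T / s * (A $ 0 $ i * B $ 0 $ j + A $ 1 $ i * B $ 1 $ j)
        + 1 / s * (A $ 1 $ i * B $ 0 $ j + u * A $ 0 $ i * B $ 1 $ j)" for i j
      by (simp add: transform_def sum_2' slice_point_def D_def algebra_simps)
    have v0: "?y (0, 0, 0) = a" "?y (0, 1, 0) = b" "?y (1, 0, 0) = c" "?y (1, 1, 0) = d"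
      unfolding k0 unfolding A_def B_def mat2_nth PB MB mult_zero_left add_0_left
      by (simp_all add: s0)
    have v1: "?y (0, 0, 1) = e" "?y (0, 1, 1) = f" "?y (1, 0, 1) = g" "?y (1, 1, 1) = h"
      unfolding k1
      unfolding A_def B_def mat2_nth PB MB PNB MNB mult_zero_left mult_zero_right add_0_left add_0_right
      by (simp_all add: slice1 slice2 efgh')
    have "x (i, j, k) = ?y (i, j, k)" for i j k
      using v0 v1 exhaust_2[of i] exhaust_2[of j] exhaust_2[of k]
      by (auto simp: abcd efgh two_eq_zero)
    then show "x = transform A B D (slice_point (meval x hyperdet / 4))"
      by (simp add: fun_eq_iff u_def)
  qed
qed

section \<open>Invariants\<close>

theorem theorem36:
  fixes f :: tensor_poly
  assumes "invariant f"
  shows "\<exists>p :: complex poly. f = peval p hyperdet"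
proof -
  define \<rho> :: "2 \<times> 2 \<times> 2 \<Rightarrow> complex poly"
    where "\<rho> = (\<lambda>_. 0)((0, 0, 0) := 1, (1, 1, 0) := 1, (1, 0, 1) := 1, (0, 1, 1) := [:0, 1:])"
  have \<rho>: "(\<lambda>i. poly (\<rho> i) u) = slice_point u" for u
    by (auto simp: \<rho>_def slice_point_def fun_eq_iff)
  obtain q where q: "\<And>u. poly q u = meval (slice_point u) f"
    using meval_along_curve[of \<rho> f] unfolding \<rho> by blast
  define p where "p = pcompose q [:0, 1 / 4:]"
  have "f - peval p hyperdet = 0"
  proof (rule mpolynomial_zeroI_generic)
    show "infinite (UNIV :: complex set)"
      by (rule infinite_UNIV_char_0)
    show "meval (slice_point 0) genericity \<noteq> 0"
      by (simp add: genericity_def slice_point_def)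
  next
    fix x
    assume "meval x genericity \<noteq> 0"
    then obtain A B D where SL2: "A \<in> SL2" "B \<in> SL2" "D \<in> SL2"
      and x: "x = transform A B D (slice_point (meval x hyperdet / 4))"
      by (rule generic_tensor_in_slice_orbit)
    have "meval x f = meval (slice_point (meval x hyperdet / 4)) (act A B D f)"
      by (subst x) (simp only: meval_act)
    also have "act A B D f = f"
      using assms SL2 by (simp add: invariant_def)
    finally show "meval x (f - peval p hyperdet) = 0"
      by (simp add: meval_peval p_def poly_pcompose flip: q)
  qed
  then show ?thesis
    by auto
qed

end
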